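(* Let $\mathbb{Y}$ be a nonempty indexing set with geodesic metric spaces $\{\mathcal{C}(Y)\}_{Y\in\mathbb{Y}}$ and projections $\{\pi_Y\}_{Y\in\mathbb{Y}}$ satisfying the strong projection axioms with projection constant $\theta$, let $K\geq 4\theta$, and let $\mathcal{C}_K(\mathbb{Y})$ be the associated quasi-tree of metric spaces. Then there exists a tree of metric spaces $\mathcal{C}_K^{\mathcal{T}}(\mathbb{Y})\subseteq\mathcal{C}_K(\mathbb{Y})$ such that the inclusion map $\mathcal{C}_K^{\mathcal{T}}(\mathbb{Y})\hookrightarrow\mathcal{C}_K(\mathbb{Y})$ is a quasiisometry.
   Context: Projections. $\mathbb{Y}$ is an indexing set; to each $Y\in\mathbb{Y}$ is associated a geodesic metric space $\mathcal{C}(Y)$ and a function (projection) $\pi_Y$ from $\mathbb{Y}\setminus\{Y\}$ to the non-empty subsets of $\mathcal{C}(Y)$. For $X,Z\in\mathbb{Y}\setminus\{Y\}$ (possibly equal) put $d_Y(X,Z)=\mathrm{diam}(\pi_Y(X)\cup\pi_Y(Z))$, the diameter being taken in $\mathcal{C}(Y)$. Strong projection axioms with projection constant $\theta\in[0,\infty)$: (P3) $\mathrm{diam}(\pi_Y(X))\leq\theta$ for all distinct $X,Y\in\mathbb{Y}$; (P4) if $X,Y,Z\in\mathbb{Y}$ are distinct and $d_Y(X,Z)>\theta$, then $d_X(Y,Z)\leq\theta$; (P5) for all $X,Z\in\mathbb{Y}$ the set $\{Y\in\mathbb{Y}\setminus\{X,Z\}: d_Y(X,Z)>\theta\}$ is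 finite; (P4') if $X,Y,Z\in\mathbb{Y}$ are distinct and $d_Y(X,Z)>\theta$, then $\pi_X(Y)=\pi_X(Z)$. Projection complex. For $X,Z\in\mathbb{Y}$ let $\mathbb{Y}_K(X,Z)=\{Y\in\mathbb{Y}\setminus\{X,Z\}: d_Y(X,Z)>K\}$. The projection complex $\mathcal{P}_K(\mathbb{Y})$ is the graph with vertex set $\mathbb{Y}$ and an edge between distinct vertices $X,Z$ whenever $\mathbb{Y}_K(X,Z)=\emptyset$. Quasi-tree of metric spaces. $\mathcal{C}_K(\mathbb{Y})$ is the space obtained from the disjoint union of the metric spaces $\mathcal{C}(Y)$, $Y\in\mathbb{Y}$, by adding an edge of length $K$ between every element of $\pi_X(Y)$ and every element of $\pi_Y(X)$ whenever $X$ and $Y$ are joined by an edge in $\mathcal{P}_K(\mathbb{Y})$. It carries the induced path metric (a pseudometric if $K=0$). Tree of metric spaces. By a tree of metric spaces $\mathcal{C}_K^{\mathcal{T}}(\mathbb{Y})\subseteq\mathcal{C}_K(\mathbb{Y})$ is meant a subspace of the following form: there are a subtree $\mathcal{T}\subseteq\mathcal{P}_K(\mathbb{Y})$ (a subgraph that is a tree) with vertex set $\mathbb{Y}$ and, for each edge $\{X,Y\}$ of $\mathcal{T}$, points $p(X,Y)\in\pi_X(Y)\subset\mathcal{C}(X)$ and $p(Y,X)\in\pi_Y(X)\subset\mathcal{C}(Y)$, such that $\mathcal{C}_K^{\mathcal{T}}(\mathbb{Y})$ consists of the disjoint union of all the $\mathcal{C}(Y)$, $Y\in\mathbb{Y}$,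 together with, for each edge $\{X,Y\}$ of $\mathcal{T}$, the single edge of length $K$ joining $p(X,Y)$ to $p(Y,X)$. It carries its own induced path metric. *)

theory Defs
  imports "HOL-Analysis.Analysis"
begin

section \<open>Geodesic metric spaces and diameters\<close>

definition geodesic_segment :: "'a metric \<Rightarrow> 'a \<Rightarrow> 'a \<Rightarrow> real \<Rightarrow> bool" where
  "geodesic_segment m x y l \<longleftrightarrow> 0 \<le> l \<and>
     (\<exists>g. g \<in> {0..l} \<rightarrow> mspace m \<and> g 0 = x \<and> g l = y \<and>
          (\<forall>s\<in>{0..l}. \<forall>t\<in>{0..l}. mdist m (g s) (g t) = \<bar>s - t\<bar>))"

definition geodesic_space :: "'a metric \<Rightarrow> bool" where
  "geodesic_space m \<longleftrightarrow> (\<forall>x\<in>mspace m. \<forall>y\<in>mspace m. \<exists>l. geodesic_segment m x y l)"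

text \<open>The diameter is extended-valued so that unbounded sets have infinite diameter.
  It is only ever applied to nonempty sets.\<close>

definition mdiam :: "'a metric \<Rightarrow> 'a set \<Rightarrow> ereal" where
  "mdiam m S = (SUP x\<in>S. SUP y\<in>S. ereal (mdist m x y))"


section \<open>Projections\<close>

text \<open>Throughout, \<open>I\<close> is the indexing set, \<open>C Y\<close> is the metric space attached to \<open>Y\<close>,
  and \<open>\<pi> Y X\<close> is the projection of \<open>X\<close> to \<open>C Y\<close>. The spaces \<open>C Y\<close> have carriers in a common
  type, but these may overlap; disjoint unions are formed with tagged points.\<close>

definition projections :: "'i set \<Rightarrow> ('i \<Rightarrow> 'a metric) \<Rightarrow> ('i \<Rightarrow> 'i \<Rightarrow> 'a set) \<Rightarrow> bool" where
  "projections I C \<pi> \<longleftrightarrow>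
     (\<forall>Y\<in>I. \<forall>X\<in>I - {Y}. \<pi> Y X \<noteq> {} \<and> \<pi> Y X \<subseteq> mspace (C Y))"

definition proj_dist ::
  "('i \<Rightarrow> 'a metric) \<Rightarrow> ('i \<Rightarrow> 'i \<Rightarrow> 'a set) \<Rightarrow> 'i \<Rightarrow> 'i \<Rightarrow> 'i \<Rightarrow> ereal" where
  "proj_dist C \<pi> Y X Z = mdiam (C Y) (\<pi> Y X \<union> \<pi> Y Z)"

definition strong_projection_axioms ::
  "'i set \<Rightarrow> ('i \<Rightarrow> 'a metric) \<Rightarrow> ('i \<Rightarrow> 'i \<Rightarrow> 'a set) \<Rightarrow> real \<Rightarrow> bool" where
  "strong_projection_axioms I C \<pi> \<theta> \<longleftrightarrow> 0 \<le> \<theta> \<and>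
     (\<forall>X\<in>I. \<forall>Y\<in>I. X \<noteq> Y \<longrightarrow> mdiam (C Y) (\<pi> Y X) \<le> ereal \<theta>) \<and>
     (\<forall>X\<in>I. \<forall>Y\<in>I. \<forall>Z\<in>I. distinct [X, Y, Z] \<longrightarrow> proj_dist C \<pi> Y X Z > ereal \<theta> \<longrightarrow>
        proj_dist C \<pi> X Y Z \<le> ereal \<theta>) \<and>
     (\<forall>X\<in>I. \<forall>Z\<in>I. finite {Y \<in> I - {X, Z}. proj_dist C \<pi> Y X Z > ereal \<theta>}) \<and>
     (\<forall>X\<in>I. \<forall>Y\<in>I. \<forall>Z\<in>I. distinct [X, Y, Z] \<longrightarrow> proj_dist C \<pi> Y X Z > ereal \<theta> \<longrightarrow>
        \<pi> X Y = \<pi> X Z)"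


section \<open>Graphs and the projection complex\<close>

text \<open>A simple graph is a pair consisting of its vertex set and its set of two-element edges.
  Both may be infinite.\<close>

type_synonym 'v ugraph = "'v set \<times> 'v set set"

definition simple_graph :: "'v ugraph \<Rightarrow> bool" where
  "simple_graph G \<longleftrightarrow> (\<forall>e\<in>snd G. e \<subseteq> fst G \<and> card e = 2)"

definition is_subgraph :: "'v ugraph \<Rightarrow> 'v ugraph \<Rightarrow> bool" where
  "is_subgraph H G \<longleftrightarrow> simple_graph H \<and> fst H \<subseteq> fst G \<and> snd H \<subseteq> snd G"

definition connected_graph :: "'v ugraph \<Rightarrow> bool" where
  "connected_graph G \<longleftrightarrow> fst G \<noteq> {} \<and>
     (\<forall>u\<in>fst G. \<forall>v\<in>fst G. (\<lambda>x y. {x, y} \<in> snd G)\<^sup>*\<^sup>* u v)"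

definition graph_cycle :: "'v ugraph \<Rightarrow> 'v list \<Rightarrow> bool" where
  "graph_cycle G vs \<longleftrightarrow> 3 \<le> length vs \<and> distinct vs \<and>
     successively (\<lambda>x y. {x, y} \<in> snd G) vs \<and> {last vs, hd vs} \<in> snd G"

definition tree_graph :: "'v ugraph \<Rightarrow> bool" where
  "tree_graph G \<longleftrightarrow> simple_graph G \<and> connected_graph G \<and> (\<nexists>vs. graph_cycle G vs)"

definition large_projections ::
  "'i set \<Rightarrow> ('i \<Rightarrow> 'a metric) \<Rightarrow> ('i \<Rightarrow> 'i \<Rightarrow> 'a set) \<Rightarrow> real \<Rightarrow> 'i \<Rightarrow> 'i \<Rightarrow> 'i set" where
  "large_projections I C \<pi> K X Z = {Y \<in> I - {X, Z}. proj_dist C \<pi> Y X Z > ereal K}"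

definition projection_complex ::
  "'i set \<Rightarrow> ('i \<Rightarrow> 'a metric) \<Rightarrow> ('i \<Rightarrow> 'i \<Rightarrow> 'a set) \<Rightarrow> real \<Rightarrow> 'i ugraph" where
  "projection_complex I C \<pi> K =
     (I, {{X, Z} | X Z. X \<in> I \<and> Z \<in> I \<and> X \<noteq> Z \<and> large_projections I C \<pi> K X Z = {}})"


section \<open>Attaching edges to a disjoint union of metric spaces\<close>

text \<open>\<open>Point Y x\<close> is the point \<open>x\<close> of the copy of \<open>C Y\<close> in the disjoint union.
  An interior point of the edge of length \<open>K\<close> between \<open>u\<close> and \<open>v\<close> is recorded as the set
  \<open>{(u, t), (v, K - t)}\<close> of its distances along the edge to the two endpoints. This does not
  depend on the orientation of the edge.\<close>

datatype ('i, 'a) glued_point =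
    Point 'i 'a
  | Edge_Point "(('i \<times> 'a) \<times> real) set"

type_synonym ('i, 'a) bridges = "(('i \<times> 'a) \<times> ('i \<times> 'a)) set"

text \<open>\<open>on_edge K u v t p\<close>: the point \<open>p\<close> lies at distance \<open>t\<close> from \<open>u\<close> along the edge of length
  \<open>K\<close> from \<open>u\<close> to \<open>v\<close>. If \<open>K = 0\<close> the edge has no interior points, but its two endpoints
  remain different points, both with parameter \<open>t = 0\<close>.\<close>

definition on_edge ::
  "real \<Rightarrow> 'i \<times> 'a \<Rightarrow> 'i \<times> 'a \<Rightarrow> real \<Rightarrow> ('i, 'a) glued_point \<Rightarrow> bool" where
  "on_edge K u v t p \<longleftrightarrow>
     t = 0 \<and> p = Point (fst u) (snd u) \<or>
     t = K \<and> p = Point (fst v) (snd v) \<or>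
     0 < t \<and> t < K \<and> p = Edge_Point {(u, t), (v, K - t)}"

definition glued_space ::
  "'i set \<Rightarrow> ('i \<Rightarrow> 'a metric) \<Rightarrow> real \<Rightarrow> ('i, 'a) bridges \<Rightarrow> ('i, 'a) glued_point set" where
  "glued_space I C K B =
     {Point Y x | Y x. Y \<in> I \<and> x \<in> mspace (C Y)} \<union> {p. \<exists>(u, v)\<in>B. \<exists>t. on_edge K u v t p}"

text \<open>\<open>glued_path I C K B p q l\<close>: there is a path of length \<open>l\<close> from \<open>p\<close> to \<open>q\<close> that is a finite
  concatenation of geodesic segments of the spaces \<open>C Y\<close> and of subsegments of attached edges.\<close>

inductive glued_path ::
  "'i set \<Rightarrow> ('i \<Rightarrow> 'a metric) \<Rightarrow> real \<Rightarrow> ('i, 'a) bridges \<Rightarrow>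
     ('i, 'a) glued_point \<Rightarrow> ('i, 'a) glued_point \<Rightarrow> real \<Rightarrow> bool"
  for I C K B where
  trivial: "p \<in> glued_space I C K B \<Longrightarrow> glued_path I C K B p p 0"
| in_space: "glued_path I C K B p (Point Y x) l \<Longrightarrow> Y \<in> I \<Longrightarrow> geodesic_segment (C Y) x y l' \<Longrightarrow>
     glued_path I C K B p (Point Y y) (l + l')"
| in_edge: "glued_path I C K B p q l \<Longrightarrow> (u, v) \<in> B \<Longrightarrow> on_edge K u v s q \<Longrightarrow> on_edge K u v t r \<Longrightarrow>
     glued_path I C K B p r (l + \<bar>s - t\<bar>)"

text \<open>The value is infinite when there is no path.\<close>

definition path_metric ::
  "'i set \<Rightarrow> ('i \<Rightarrow> 'a metric) \<Rightarrow> real \<Rightarrow> ('i, 'a) bridges \<Rightarrow>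
     ('i, 'a) glued_point \<Rightarrow> ('i, 'a) glued_point \<Rightarrow> ereal" where
  "path_metric I C K B p q = (INF l\<in>{l. glued_path I C K B p q l}. ereal l)"


section \<open>Quasi-trees and trees of metric spaces\<close>

definition quasi_tree_bridges ::
  "'i set \<Rightarrow> ('i \<Rightarrow> 'a metric) \<Rightarrow> ('i \<Rightarrow> 'i \<Rightarrow> 'a set) \<Rightarrow> real \<Rightarrow> ('i, 'a) bridges" where
  "quasi_tree_bridges I C \<pi> K =
     {((X, x), (Y, y)) | X x Y y. {X, Y} \<in> snd (projection_complex I C \<pi> K) \<and> x \<in> \<pi> X Y \<and> y \<in> \<pi> Y X}"

definition quasi_tree_space ::
  "'i set \<Rightarrow> ('i \<Rightarrow> 'a metric) \<Rightarrow> ('i \<Rightarrow> 'i \<Rightarrow> 'a set) \<Rightarrow> real \<Rightarrow> ('i, 'a) glued_point set" where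
  "quasi_tree_space I C \<pi> K = glued_space I C K (quasi_tree_bridges I C \<pi> K)"

definition quasi_tree_metric ::
  "'i set \<Rightarrow> ('i \<Rightarrow> 'a metric) \<Rightarrow> ('i \<Rightarrow> 'i \<Rightarrow> 'a set) \<Rightarrow> real \<Rightarrow>
     ('i, 'a) glued_point \<Rightarrow> ('i, 'a) glued_point \<Rightarrow> ereal" where
  "quasi_tree_metric I C \<pi> K = path_metric I C K (quasi_tree_bridges I C \<pi> K)"

text \<open>The data defining a tree of metric spaces inside the quasi-tree of metric spaces. Since
  \<open>{X, Y}\<close> is unordered, the last condition constrains both \<open>p X Y\<close> and \<open>p Y X\<close>.\<close>

definition tree_of_spaces_data ::
  "'i set \<Rightarrow> ('i \<Rightarrow> 'a metric) \<Rightarrow> ('i \<Rightarrow> 'i \<Rightarrow> 'a set) \<Rightarrow> real \<Rightarrow>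
     'i ugraph \<Rightarrow> ('i \<Rightarrow> 'i \<Rightarrow> 'a) \<Rightarrow> bool" where
  "tree_of_spaces_data I C \<pi> K T p \<longleftrightarrow>
     is_subgraph T (projection_complex I C \<pi> K) \<and> tree_graph T \<and> fst T = I \<and>
     (\<forall>X Y. {X, Y} \<in> snd T \<longrightarrow> p X Y \<in> \<pi> X Y)"

definition tree_bridges :: "'i ugraph \<Rightarrow> ('i \<Rightarrow> 'i \<Rightarrow> 'a) \<Rightarrow> ('i, 'a) bridges" where
  "tree_bridges T p = {((X, p X Y), (Y, p Y X)) | X Y. {X, Y} \<in> snd T}"

definition tree_space ::
  "'i set \<Rightarrow> ('i \<Rightarrow> 'a metric) \<Rightarrow> real \<Rightarrow> 'i ugraph \<Rightarrow> ('i \<Rightarrow> 'i \<Rightarrow> 'a) \<Rightarrow>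
     ('i, 'a) glued_point set" where
  "tree_space I C K T p = glued_space I C K (tree_bridges T p)"

definition tree_metric ::
  "'i set \<Rightarrow> ('i \<Rightarrow> 'a metric) \<Rightarrow> real \<Rightarrow> 'i ugraph \<Rightarrow> ('i \<Rightarrow> 'i \<Rightarrow> 'a) \<Rightarrow>
     ('i, 'a) glued_point \<Rightarrow> ('i, 'a) glued_point \<Rightarrow> ereal" where
  "tree_metric I C K T p = path_metric I C K (tree_bridges T p)"


section \<open>Quasi-isometries\<close>

definition quasi_isometry ::
  "'p set \<Rightarrow> ('p \<Rightarrow> 'p \<Rightarrow> ereal) \<Rightarrow> 'q set \<Rightarrow> ('q \<Rightarrow> 'q \<Rightarrow> ereal) \<Rightarrow> ('p \<Rightarrow> 'q) \<Rightarrow> bool" where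
  "quasi_isometry S d S' d' f \<longleftrightarrow> f \<in> S \<rightarrow> S' \<and>
     (\<exists>L A. 1 \<le> L \<and> 0 \<le> A \<and>
        (\<forall>x\<in>S. \<forall>y\<in>S.
           ereal (1 / L) * d x y - ereal A \<le> d' (f x) (f y) \<and>
           d' (f x) (f y) \<le> ereal L * d x y + ereal A) \<and>
        (\<forall>z\<in>S'. \<exists>x\<in>S. d' z (f x) \<le> ereal A))"

end

theory Submission
  imports Defs
begin

text \<open>
  Fix a base vertex \<open>b\<close> and call the elements of \<open>\<Y>\<^sub>K(b, X) \<union> {b}\<close> the ancestors of \<open>X \<noteq> b\<close>.
  The axiom that \<open>d\<^sub>Y(X, Z) > \<theta>\<close> forces \<open>\<pi>\<^sub>X(Y) = \<pi>\<^sub>X(Z)\<close> makes this a tree order: ancestors of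
  ancestors are ancestors, and the finitely many ancestors of \<open>X\<close> are linearly ordered
  (\<open>ancestor_trans_proj\<close>, \<open>ancestors_linear\<close>). So \<open>X\<close> has a closest ancestor, its parent, and
  joining every vertex to its parent gives a spanning tree. Its edges lie in the projection
  complex, because a vertex that sees \<open>X\<close> and its parent far apart would be an ancestor of \<open>X\<close>
  strictly between them (\<open>Y_K_parent\<close>). The attaching points of the tree are chosen arbitrarily
  in the projections.

  The inclusion is a quasi-isometry as soon as the endpoints of every bridge of the quasi-tree of
  spaces have distance at most \<open>c * K\<close> in the tree of spaces, with one constant \<open>c\<close>
  (\<open>quasi_isometry_of_bridge_bound\<close>). It matters that this bound is a multiple of \<open>K\<close>: for
  \<open>K = 0\<close> bridges have no length, so that the length of a path does not control how many it
  crosses.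

  Let then \<open>X\<close> and \<open>Z\<close> be adjacent in the projection complex. If one of them is an ancestor of the
  other, then it is its parent (\<open>near_edge_ancestor\<close>). Otherwise the tree path from \<open>X\<close> to \<open>Z\<close>
  climbs to the closest common ancestor \<open>M\<close> and descends again. The jump that it makes inside the
  space of a vertex \<open>V\<close> can be read off from the projections of \<open>X\<close>, \<open>Z\<close> and \<open>b\<close>: to an ancestor
  \<open>U\<close> of \<open>V\<close> any vertex below \<open>V\<close> looks like \<open>V\<close>, and to \<open>V\<close> the vertex \<open>U\<close> looks like \<open>b\<close>.
  At \<open>M\<close> the jump is bounded by \<open>d\<^sub>M(X, Z) \<le> K\<close>. At an ancestor \<open>V\<close> of \<open>X\<close> below \<open>M\<close> it is bounded
  by \<open>d\<^sub>V(X, b) \<le> d\<^sub>V(X, Z) + d\<^sub>V(Z, b) \<le> 2 * K\<close>, since \<open>V\<close> is not an ancestor of \<open>Z\<close>.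
  Finally there are at most two such \<open>V\<close> on either side (\<open>few_separating_ancestors\<close>), so the total
  is at most \<open>23 * K\<close> (\<open>near_edge\<close>).
\<close>

section \<open>Trees given by parent maps\<close>

text \<open>
  The height \<open>h\<close> gives both halves of the claim: going to the parent ends at the root \<open>b\<close>, and a
  vertex of maximal height in a cycle would have its parent as both of its neighbours.
\<close>

lemma tree_graph_parent:
  fixes h :: "'v \<Rightarrow> nat"
  assumes b: "b \<in> I"
    and par: "\<And>X. X \<in> I - {b} \<Longrightarrow> par X \<in> I"
    and less: "\<And>X. X \<in> I - {b} \<Longrightarrow> h (par X) < h X"
  shows "tree_graph (I, {{X, par X} | X. X \<in> I - {b}})"
proof -
  define E where "E = {{X, par X} | X. X \<in> I - {b}}"
  let ?adj = "\<lambda>x y. {x, y} \<in> E"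
  have simple: "simple_graph (I, E)"
    using par less unfolding simple_graph_def E_def by (fastforce simp: card_2_iff)
  have sym: "?adj x y" if "?adj y x" for x y
    using that by (simp only: insert_commute)
  have to_root: "?adj\<^sup>*\<^sup>* X b" if "X \<in> I" for X
    using that
  proof (induction X rule: measure_induct_rule[where f = h])
    case (less X)
    show ?case
    proof (cases "X = b")
      case False
      with less.prems have X: "X \<in> I - {b}" by simp
      then have "?adj X (par X)" unfolding E_def by blast
      moreover have "?adj\<^sup>*\<^sup>* (par X) b"
        using less.IH par[OF X] assms(3)[OF X] by blast
      ultimately show ?thesis by (rule converse_rtranclp_into_rtranclp)
    qed simp
  qed
  have "symp ?adj" using sym by (auto intro!: sympI)
  then have "?adj\<^sup>*\<^sup>* b X" if "X \<in> I" for X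
    using to_root[OF that] by (blast dest: symp_rtranclp sympD)
  with to_root have "connected_graph (I, E)"
    using b unfolding connected_graph_def fst_conv snd_conv by (blast intro: rtranclp_trans)
  moreover have "\<not> graph_cycle (I, E) vs" for vs
  proof
    assume "graph_cycle (I, E) vs"
    then have len: "3 \<le> length vs" and dist: "distinct vs"
      and succ: "successively ?adj vs" and close: "?adj (last vs) (hd vs)"
      unfolding graph_cycle_def snd_conv by blast+
    have "finite (h ` set vs)" "h ` set vs \<noteq> {}" using len by auto
    then have "Max (h ` set vs) \<in> h ` set vs" by (rule Max_in)
    then obtain v where v: "v \<in> set vs" "h v = Max (h ` set vs)" by auto
    then have max: "h u \<le> h v" if "u \<in> set vs" for u using that by simp
    have up: "u = par v" if "?adj v u" "u \<in> set vs" for u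
    proof -
      obtain X where X: "X \<in> I - {b}" "{v, u} = {X, par X}"
        using \<open>?adj v u\<close> unfolding E_def by blast
      with less[OF X(1)] max[OF that(2)] show ?thesis by (auto simp: doubleton_eq_iff)
    qed
    obtain xs ys where vs: "vs = xs @ v # ys" using v(1) by (meson split_list)
    \<comment> \<open>the rest of the cycle, read from one neighbour of \<open>v\<close> around to the other\<close>
    define ws where "ws = ys @ xs"
    have ws: "distinct ws" "set ws \<subseteq> set vs" "2 \<le> length ws"
      using dist len unfolding vs ws_def by auto
    then have "ws \<noteq> []" by auto
    have "?adj v (hd ws)"
    proof (cases ys)
      case Nil
      then show ?thesis using close \<open>ws \<noteq> []\<close> unfolding vs ws_def by simp
    next
      case (Cons y zs)
      then show ?thesis using succ unfolding vs ws_def by (simp add: successively_append_iff)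
    qed
    moreover have "?adj (last ws) v"
    proof (cases xs rule: rev_cases)
      case Nil
      then show ?thesis using close \<open>ws \<noteq> []\<close> unfolding vs ws_def by simp
    next
      case (snoc zs x)
      then show ?thesis using succ unfolding vs ws_def by (simp add: successively_append_iff)
    qed
    ultimately have "hd ws = par v" "last ws = par v"
      using up sym ws(2) \<open>ws \<noteq> []\<close> by (metis hd_in_set last_in_set subsetD)+
    then have "ws ! 0 = ws ! (length ws - 1)"
      using \<open>ws \<noteq> []\<close> by (simp add: hd_conv_nth last_conv_nth)
    with nth_eq_iff_index_eq[OF ws(1), of 0 "length ws - 1"] have "0 = length ws - 1"
      using \<open>ws \<noteq> []\<close> by simp
    with ws(3) show False by linarith
  qed
  ultimately show ?thesis using simple unfolding tree_graph_def E_def by blast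
qed


section \<open>Paths in glued spaces\<close>

lemma geodesic_segment_sym:
  assumes "geodesic_segment m x y l"
  shows "geodesic_segment m y x l"
proof -
  obtain g where l: "0 \<le> l" and g: "g \<in> {0..l} \<rightarrow> mspace m" "g 0 = x" "g l = y"
    and d: "\<forall>s\<in>{0..l}. \<forall>t\<in>{0..l}. mdist m (g s) (g t) = \<bar>s - t\<bar>"
    using assms unfolding geodesic_segment_def by blast
  let ?g = "\<lambda>t. g (l - t)"
  have "?g \<in> {0..l} \<rightarrow> mspace m" "?g 0 = y" "?g l = x" using g by auto
  moreover have "\<forall>s\<in>{0..l}. \<forall>t\<in>{0..l}. mdist m (?g s) (?g t) = \<bar>s - t\<bar>" using d by auto
  ultimately show ?thesis using l unfolding geodesic_segment_def by blast
qed

lemma geodesic_segmentD: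
  assumes "geodesic_segment m x y l"
  shows "0 \<le> l" "x \<in> mspace m" "y \<in> mspace m" "mdist m x y = l"
  using assms unfolding geodesic_segment_def by force+

text \<open>
  Working with an actual path of bounded length, rather than with the infimum that defines the path
  metric, allows paths to be concatenated and reversed without passing to approximations.
\<close>

definition path_within where
  "path_within I C K B p q r \<longleftrightarrow> (\<exists>l\<le>r. glued_path I C K B p q l)"

lemma path_within_mono:
  "path_within I C K B p q r \<Longrightarrow> r \<le> r' \<Longrightarrow> path_within I C K B p q r'"
  unfolding path_within_def by (blast intro: order_trans)

lemma glued_path_append:
  assumes "glued_path I C K B q r l'" "glued_path I C K B p q l"
  shows "glued_path I C K B p r (l + l')"
  using assms
proof induction
  case (in_space q Y x l' y l'')
  from glued_path.in_space[OF in_space.IH[OF in_space.prems] in_space.hyps(2,3)]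
  show ?case by (simp add: add.assoc)
next
  case (in_edge q q' l' u v s t r)
  from glued_path.in_edge[OF in_edge.IH[OF in_edge.prems] in_edge.hyps(2-4)]
  show ?case by (simp add: add.assoc)
qed simp

lemma path_within_trans:
  assumes "path_within I C K B p q r" "path_within I C K B q q' r'"
  shows "path_within I C K B p q' (r + r')"
  using assms glued_path_append unfolding path_within_def by (metis add_mono)

lemma on_edge_in_glued_space:
  "(u, v) \<in> B \<Longrightarrow> on_edge K u v t p \<Longrightarrow> p \<in> glued_space I C K B"
  unfolding glued_space_def by blast

lemma glued_path_edge:
  assumes "(u, v) \<in> B" "on_edge K u v s p" "on_edge K u v t q"
  shows "glued_path I C K B p q \<bar>s - t\<bar>"
  using glued_path.in_edge[OF glued_path.trivial[OF on_edge_in_glued_space[OF assms(1,2)]] assms]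
  by simp

lemma glued_path_segment:
  assumes "Y \<in> I" "geodesic_segment (C Y) x y l"
  shows "glued_path I C K B (Point Y x) (Point Y y) l"
proof -
  have "Point Y x \<in> glued_space I C K B"
    using assms(1) geodesic_segmentD(2)[OF assms(2)] unfolding glued_space_def by blast
  from glued_path.in_space[OF glued_path.trivial[OF this] assms] show ?thesis by simp
qed

lemma glued_path_sym:
  assumes "glued_path I C K B p q l"
  shows "glued_path I C K B q p l"
  using assms
proof induction
  case (trivial p)
  then show ?case by (rule glued_path.trivial)
next
  case (in_space p Y x l y l')
  have "glued_path I C K B (Point Y y) (Point Y x) l'"
    using in_space.hyps by (blast intro: glued_path_segment geodesic_segment_sym)
  from glued_path_append[OF in_space.IH this] show ?case by (simp add: add.commute)
next
  case (in_edge p q l u v s t r)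
  from glued_path_append[OF in_edge.IH glued_path_edge[OF in_edge.hyps(2,4,3)]]
  show ?case by (simp add: add.commute abs_minus_commute)
qed

lemma path_within_sym:
  "path_within I C K B p q r \<Longrightarrow> path_within I C K B q p r"
  using glued_path_sym unfolding path_within_def by metis

lemma path_within_space:
  assumes "Y \<in> I" "geodesic_space (C Y)" "x \<in> mspace (C Y)" "y \<in> mspace (C Y)"
    "mdist (C Y) x y \<le> r"
  shows "path_within I C K B (Point Y x) (Point Y y) r"
proof -
  obtain l where "geodesic_segment (C Y) x y l"
    using assms(2-4) unfolding geodesic_space_def by blast
  with assms glued_path_segment geodesic_segmentD(4) show ?thesis
    unfolding path_within_def by metis
qed

lemma path_within_bridge:
  assumes "((X, x), (Y, y)) \<in> B" "0 \<le> K"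
  shows "path_within I C K B (Point X x) (Point Y y) K"
proof -
  have "on_edge K (X, x) (Y, y) 0 (Point X x)" "on_edge K (X, x) (Y, y) K (Point Y y)"
    by (auto simp: on_edge_def)
  from glued_path_edge[OF assms(1) this] assms(2) show ?thesis
    unfolding path_within_def by fastforce
qed

lemma on_edge_bounds: "0 \<le> K \<Longrightarrow> on_edge K u v t p \<Longrightarrow> 0 \<le> t \<and> t \<le> K"
  unfolding on_edge_def by auto

text \<open>
  It suffices to compare distances between points of the spaces themselves: a point inside a bridge
  is within \<open>K\<close> of an end of the bridge.
\<close>

lemma glued_space_near_point:
  assumes "q \<in> glued_space I C K B" "0 \<le> K"
    and "\<And>u v. (u, v) \<in> B \<Longrightarrow> fst u \<in> I \<and> snd u \<in> mspace (C (fst u))"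
  obtains Y x where "Y \<in> I" "x \<in> mspace (C Y)" "path_within I C K B q (Point Y x) K"
proof -
  consider (pt) Y x where "q = Point Y x" "Y \<in> I" "x \<in> mspace (C Y)"
    | (edge) u v t where "(u, v) \<in> B" "on_edge K u v t q"
    using assms(1) unfolding glued_space_def by blast
  then show ?thesis
  proof cases
    case pt
    then have "path_within I C K B q q K"
      using glued_path.trivial[OF assms(1)] assms(2) unfolding path_within_def by blast
    with pt that show ?thesis by blast
  next
    case edge
    have "on_edge K u v 0 (Point (fst u) (snd u))" by (simp add: on_edge_def)
    from glued_path_edge[OF edge(1,2) this] on_edge_bounds[OF assms(2) edge(2)]
    have "path_within I C K B q (Point (fst u) (snd u)) K"
      unfolding path_within_def by fastforce
    with that assms(3)[OF edge(1)] show ?thesis by blast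
  qed
qed

lemma glued_space_mono: "B \<subseteq> B' \<Longrightarrow> glued_space I C K B \<subseteq> glued_space I C K B'"
  unfolding glued_space_def by blast

lemma glued_path_mono:
  assumes "glued_path I C K B p q l" "B \<subseteq> B'"
  shows "glued_path I C K B' p q l"
  using assms(1)
proof induction
  case (trivial p)
  then have "p \<in> glued_space I C K B'" using glued_space_mono[OF assms(2)] by blast
  then show ?case by (rule glued_path.trivial)
next
  case in_space
  then show ?case by (auto intro: glued_path.in_space)
next
  case in_edge
  then show ?case using assms(2) by (auto intro: glued_path.in_edge)
qed

text \<open>
  The distance in the smaller space from a fixed point grows at most \<open>c\<close> times as fast as the
  length of a path in the larger space. A path may stop or turn inside a bridge that is not
  part of the smaller space. Inside the bridge the comparison is therefore made at its ends, whose
  distances along the bridge are exactly what \<open>Edge_Point S\<close> records in \<open>S\<close>. This is what makes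
  the induction over the steps of the path go through.
\<close>

lemma path_within_of_bridge_bound:
  assumes path: "glued_path I C K B' (Point X x) q l"
    and K: "0 \<le> K" and c: "1 \<le> c"
    and bridge: "\<And>u v. (u, v) \<in> B' \<Longrightarrow>
      path_within I C K B (Point (fst u) (snd u)) (Point (fst v) (snd v)) (c * K)"
    and X: "X \<in> I" "x \<in> mspace (C X)"
  shows "case q of
      Point Y y \<Rightarrow> path_within I C K B (Point X x) (Point Y y) (c * l)
    | Edge_Point S \<Rightarrow> \<forall>(u, t)\<in>S.
        path_within I C K B (Point X x) (Point (fst u) (snd u)) (c * (l + t))"
    (is "?inv q l")
  using path
proof (induction "Point X x" q l)
  case trivial
  have "Point X x \<in> glued_space I C K B" using X unfolding glued_space_def by blast
  then show ?case
    using glued_path.trivial unfolding path_within_def by fastforce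
next
  case (in_space Y y l z l')
  have "path_within I C K B (Point Y y) (Point Y z) (c * l')"
    using glued_path_segment[of Y I C, OF in_space(3,4)] geodesic_segmentD(1)[OF in_space(4)] c
    unfolding path_within_def by (metis mult_right_mono mult_1)
  from path_within_trans[OF _ this] in_space(2) show ?case by (simp add: distrib_left)
next
  case (in_edge q l u v s t r)
  \<comment> \<open>whether \<open>q\<close> is an end of the bridge or inside it, both ends are controlled by the position of \<open>q\<close>\<close>
  let ?near = "\<lambda>w. path_within I C K B (Point X x) (Point (fst w) (snd w))"
  note uv = bridge[OF in_edge(3)]
  have "?near u (c * (l + s)) \<and> ?near v (c * (l + (K - s)))"
    using in_edge(4) unfolding on_edge_def
  proof (elim disjE conjE)
    assume q: "s = 0" "q = Point (fst u) (snd u)"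
    with in_edge(2) have "?near u (c * l)" by simp
    from this path_within_trans[OF this uv] show ?thesis
      using q by (simp add: algebra_simps)
  next
    assume q: "s = K" "q = Point (fst v) (snd v)"
    with in_edge(2) have "?near v (c * l)" by simp
    from this path_within_trans[OF this path_within_sym[OF uv]] show ?thesis
      using q by (simp add: algebra_simps)
  next
    assume "q = Edge_Point {(u, s), (v, K - s)}"
    with in_edge(2) show ?thesis by simp
  qed
  then have "?near u (c * (l + s))" and "?near v (c * (l + (K - s)))" by blast+
  note near = this[THEN path_within_mono]
  have "l + s \<le> l + \<bar>s - t\<bar> + t" "l + (K - s) \<le> l + \<bar>s - t\<bar> + (K - t)" by auto
  then have le: "c * (l + s) \<le> c * (l + \<bar>s - t\<bar> + t)"
    "c * (l + (K - s)) \<le> c * (l + \<bar>s - t\<bar> + (K - t))"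
    using c by (auto intro: mult_left_mono)
  from in_edge(5) show ?case unfolding on_edge_def
    using near(1)[OF le(1)] near(2)[OF le(2)] by (elim disjE conjE) auto
qed

lemma path_metric_le:
  "path_within I C K B p q r \<Longrightarrow> path_metric I C K B p q \<le> ereal r"
  unfolding path_within_def path_metric_def by (auto intro: INF_lower2)

lemma glued_path_nonneg: "glued_path I C K B p q l \<Longrightarrow> 0 \<le> l"
  by (induction rule: glued_path.induct) (auto dest: geodesic_segmentD(1))

lemma path_metric_nonneg: "0 \<le> path_metric I C K B p q"
  unfolding path_metric_def by (auto intro!: INF_greatest dest: glued_path_nonneg)

text \<open>
  Moving both ends of a path to points of the spaces costs at most \<open>2 * K\<close> in each of the two
  metrics; this is the source of the additive constant.
\<close>

lemma quasi_isometry_of_bridge_bound: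
  assumes K: "0 \<le> K" and c: "1 \<le> c" and sub: "B \<subseteq> B'"
    and mem: "\<And>u v. (u, v) \<in> B' \<Longrightarrow> fst u \<in> I \<and> snd u \<in> mspace (C (fst u))"
    and bridge: "\<And>u v. (u, v) \<in> B' \<Longrightarrow>
      path_within I C K B (Point (fst u) (snd u)) (Point (fst v) (snd v)) (c * K)"
  shows "quasi_isometry (glued_space I C K B) (path_metric I C K B)
    (glued_space I C K B') (path_metric I C K B') (\<lambda>x. x)"
proof -
  let ?A = "2 * c * K + 2 * K"
  let ?d = "path_metric I C K B" and ?d' = "path_metric I C K B'"
  have A: "0 \<le> ?A" using K c by simp
  have "K \<le> ?A" using K c by (simp add: add_increasing)
  have lower: "ereal (1 / c) * ?d p q - ereal ?A \<le> ?d' p q"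
    if p: "p \<in> glued_space I C K B" and q: "q \<in> glued_space I C K B" for p q
    unfolding path_metric_def[of I C K B']
  proof (rule INF_greatest, clarify)
    fix l assume l: "glued_path I C K B' p q l"
    obtain X x where X: "X \<in> I" "x \<in> mspace (C X)" "path_within I C K B p (Point X x) K"
      using glued_space_near_point[OF p K] mem sub by blast
    obtain Y y where Y: "Y \<in> I" "y \<in> mspace (C Y)" "path_within I C K B q (Point Y y) K"
      using glued_space_near_point[OF q K] mem sub by blast
    obtain l1 where l1: "l1 \<le> K" "glued_path I C K B' p (Point X x) l1"
      using X(3) glued_path_mono[OF _ sub] unfolding path_within_def by blast
    obtain l2 where l2: "l2 \<le> K" "glued_path I C K B' q (Point Y y) l2"
      using Y(3) glued_path_mono[OF _ sub] unfolding path_within_def by blast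
    have "glued_path I C K B' (Point X x) (Point Y y) (l1 + l + l2)"
      using l l1(2) l2(2) by (meson glued_path_append glued_path_sym)
    from path_within_of_bridge_bound[OF this K c bridge X(1,2)]
    have "path_within I C K B (Point X x) (Point Y y) (c * (l1 + l + l2))" by simp
    moreover have "c * (l1 + l + l2) \<le> c * (l + 2 * K)"
      using c l1 l2 by (intro mult_left_mono) auto
    ultimately have "path_within I C K B (Point X x) (Point Y y) (c * (l + 2 * K))"
      by (rule path_within_mono)
    with X(3) Y(3) have "path_within I C K B p q (K + c * (l + 2 * K) + K)"
      by (meson path_within_trans path_within_sym)
    then have "?d p q \<le> ereal (K + c * (l + 2 * K) + K)" by (rule path_metric_le)
    then have "ereal (1 / c) * ?d p q \<le> ereal (1 / c) * ereal (K + c * (l + 2 * K) + K)"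
      using c by (intro ereal_mult_left_mono) auto
    also have "\<dots> = ereal (l + (2 * c * K + 2 * K) / c)"
      using c by (simp add: field_simps)
    also have "\<dots> \<le> ereal (l + ?A)"
      using A c by (simp add: divide_le_eq mult_left_le del: distrib_left_numeral)
        (metis A mult.commute mult_left_mono mult_1)
    finally show "ereal (1 / c) * ?d p q - ereal ?A \<le> ereal l"
      by (simp add: ereal_minus_le_iff add.commute)
  qed
  have upper: "?d' p q \<le> ereal c * ?d p q + ereal ?A" for p q
  proof -
    have "?d' p q \<le> ?d p q"
      unfolding path_metric_def using glued_path_mono[OF _ sub] by (intro INF_superset_mono) auto
    also have "\<dots> \<le> ereal c * ?d p q"
      using ereal_mult_right_mono[OF _ path_metric_nonneg, where a = 1 and b = "ereal c"] c
      by simp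
    also have "\<dots> \<le> ereal c * ?d p q + ereal ?A" using A by (simp add: ereal_le_add_self)
    finally show ?thesis .
  qed
  have dense: "\<exists>x\<in>glued_space I C K B. ?d' z x \<le> ereal ?A" if z: "z \<in> glued_space I C K B'" for z
  proof -
    obtain Y y where Y: "Y \<in> I" "y \<in> mspace (C Y)" "path_within I C K B' z (Point Y y) K"
      using glued_space_near_point[OF z K] mem by blast
    then have "Point Y y \<in> glued_space I C K B" unfolding glued_space_def by blast
    moreover have "?d' z (Point Y y) \<le> ereal ?A"
      using path_metric_le[OF path_within_mono[OF Y(3) \<open>K \<le> ?A\<close>]] .
    ultimately show ?thesis by blast
  qed
  show ?thesis
    unfolding quasi_isometry_def
    using glued_space_mono[OF sub] c A lower upper dense by blast
qed


section \<open>Projections\<close>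

lemma mdiam_le_iff: "mdiam m S \<le> ereal r \<longleftrightarrow> (\<forall>x\<in>S. \<forall>y\<in>S. mdist m x y \<le> r)"
  unfolding mdiam_def by (simp add: SUP_le_iff)

lemma mdiam_Un_le:
  assumes "mdiam m (S \<union> T) \<le> ereal r" "mdiam m (T \<union> U) \<le> ereal r'" "T \<noteq> {}"
    and "S \<subseteq> mspace m" "T \<subseteq> mspace m" "U \<subseteq> mspace m"
  shows "mdiam m (S \<union> U) \<le> ereal (r + r')"
  unfolding mdiam_le_iff
proof (intro ballI)
  fix x y assume xy: "x \<in> S \<union> U" "y \<in> S \<union> U"
  obtain t where t: "t \<in> T" using assms(3) by blast
  have ST: "mdist m x y \<le> r" if "x \<in> S \<union> T" "y \<in> S \<union> T" for x y
    using assms(1) that unfolding mdiam_le_iff by blast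
  have TU: "mdist m x y \<le> r'" if "x \<in> T \<union> U" "y \<in> T \<union> U" for x y
    using assms(2) that unfolding mdiam_le_iff by blast
  have tri: "mdist m x y \<le> mdist m x t + mdist m t y"
    by (rule mdist_triangle) (use xy t assms in auto)
  have "0 \<le> r" "0 \<le> r'" using t order_trans[OF mdist_nonneg ST[of t t]] order_trans[OF mdist_nonneg TU[of t t]]
    by auto
  with xy t tri ST[of x y] TU[of x y] ST[of x t] TU[of t y] TU[of x t] ST[of t y]
  show "mdist m x y \<le> r + r'" by (elim UnE) auto
qed

text \<open>
  The inequality \<open>2 * \<theta> \<le> K\<close> is what makes the sum of two distances that are at most \<open>\<theta>\<close> too small
  to exceed \<open>K\<close> (see \<open>d_split\<close> below).
\<close>

locale strong_projections =
  fixes I :: "'i set" and C :: "'i \<Rightarrow> 'a metric" and \<pi> :: "'i \<Rightarrow> 'i \<Rightarrow> 'a set"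
    and \<theta> K :: real
  assumes geodesic: "Y \<in> I \<Longrightarrow> geodesic_space (C Y)"
    and projections: "projections I C \<pi>"
    and strong_axioms: "strong_projection_axioms I C \<pi> \<theta>"
    and K: "2 * \<theta> \<le> K"
begin

abbreviation d where "d \<equiv> proj_dist C \<pi>"

lemma \<theta>: "0 \<le> \<theta>" "\<theta> \<le> K" "0 \<le> K"
  using strong_axioms K unfolding strong_projection_axioms_def by auto

lemma \<theta>_less: "ereal K < r \<Longrightarrow> ereal \<theta> < r"
  using \<theta>(2) by (meson ereal_less_eq(3) le_less_trans)

lemma proj_nonempty: "Y \<in> I \<Longrightarrow> X \<in> I \<Longrightarrow> X \<noteq> Y \<Longrightarrow> \<pi> Y X \<noteq> {}"
  and proj_mspace: "Y \<in> I \<Longrightarrow> X \<in> I \<Longrightarrow> X \<noteq> Y \<Longrightarrow> \<pi> Y X \<subseteq> mspace (C Y)"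
  using projections unfolding projections_def by auto

lemma proj_diam:
  "Y \<in> I \<Longrightarrow> X \<in> I \<Longrightarrow> X \<noteq> Y \<Longrightarrow> x \<in> \<pi> Y X \<Longrightarrow> y \<in> \<pi> Y X \<Longrightarrow> mdist (C Y) x y \<le> \<theta>"
  using strong_axioms mdiam_le_iff[of "C Y" "\<pi> Y X" \<theta>] unfolding strong_projection_axioms_def by blast

lemma d_commute: "d Y X Z = d Y Z X"
  by (simp add: proj_dist_def Un_commute)

text \<open>
  Distances are determined by the projections, so equal projections can be exchanged. This turns
  the equalities supplied by the axioms into inequalities at other vertices.
\<close>

lemma d_cong: "\<pi> Y X = \<pi> Y X' \<Longrightarrow> d Y X Z = d Y X' Z"
  by (simp add: proj_dist_def)

lemma d_same_le: "Y \<in> I \<Longrightarrow> X \<in> I \<Longrightarrow> X \<noteq> Y \<Longrightarrow> \<pi> Y X = \<pi> Y Z \<Longrightarrow> d Y X Z \<le> ereal \<theta>"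
  using proj_diam unfolding proj_dist_def by (auto simp: mdiam_le_iff)

lemma d_bound:
  "d Y X Z \<le> ereal r \<Longrightarrow> x \<in> \<pi> Y X \<union> \<pi> Y Z \<Longrightarrow> y \<in> \<pi> Y X \<union> \<pi> Y Z \<Longrightarrow> mdist (C Y) x y \<le> r"
  unfolding proj_dist_def mdiam_le_iff by blast

lemma d_triangle:
  assumes "d Y X W \<le> ereal r" "d Y W Z \<le> ereal r'"
    and "{X, W, Z} \<subseteq> I - {Y}" "Y \<in> I"
  shows "d Y X Z \<le> ereal (r + r')"
  using assms mdiam_Un_le[of "C Y" "\<pi> Y X" "\<pi> Y W" r "\<pi> Y Z" r'] proj_nonempty[of Y W]
    proj_mspace[of Y]
  unfolding proj_dist_def by auto

lemma d_split:
  assumes "ereal K < d Y X Z" "{X, W, Z} \<subseteq> I - {Y}" "Y \<in> I"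
  shows "ereal \<theta> < d Y X W \<or> ereal \<theta> < d Y W Z"
proof (rule ccontr)
  assume "\<not> ?thesis"
  then have "d Y X Z \<le> ereal (\<theta> + \<theta>)" using d_triangle[OF _ _ assms(2,3), of \<theta> \<theta>] by (simp add: not_less)
  also have "\<dots> \<le> ereal K" using K by simp
  finally show False using assms(1) by simp
qed

lemma proj_eq_of_far:
  assumes "ereal \<theta> < d Y X Z" "X \<in> I" "Y \<in> I" "Z \<in> I" "distinct [X, Y, Z]"
  shows "\<pi> X Y = \<pi> X Z"
  using strong_axioms assms unfolding strong_projection_axioms_def by blast

abbreviation Y_K where "Y_K \<equiv> large_projections I C \<pi> K"

lemma Y_K_iff: "Y \<in> Y_K X Z \<longleftrightarrow> Y \<in> I \<and> Y \<noteq> X \<and> Y \<noteq> Z \<and> ereal K < d Y X Z"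
  by (auto simp: large_projections_def)

lemma Y_K_commute: "Y_K X Z = Y_K Z X"
  by (auto simp: Y_K_iff d_commute)

lemma finite_Y_K: "X \<in> I \<Longrightarrow> Z \<in> I \<Longrightarrow> finite (Y_K X Z)"
proof -
  assume XZ: "X \<in> I" "Z \<in> I"
  then have "finite {Y \<in> I - {X, Z}. ereal \<theta> < d Y X Z}"
    using strong_axioms unfolding strong_projection_axioms_def by blast
  then show ?thesis by (rule rev_finite_subset) (auto simp: Y_K_iff \<theta>_less)
qed

end

section \<open>The tree order of the standard paths from a base vertex\<close>

locale rooted_projections = strong_projections +
  fixes b
  assumes b: "b \<in> I"
begin

text \<open>
  These are the vertices before \<open>X\<close> on the standard path of the projection complex from \<open>b\<close> to \<open>X\<close>.
\<close>

definition ancestors where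
  "ancestors X = (if X = b then {} else insert b (Y_K b X))"

lemma ancestors_iff:
  "V \<in> ancestors X \<longleftrightarrow>
     V \<in> I \<and> X \<noteq> b \<and> V \<noteq> X \<and> (V = b \<or> ereal K < d V b X)"
  using b by (auto simp: ancestors_def Y_K_iff)

lemma finite_ancestors: "X \<in> I \<Longrightarrow> finite (ancestors X)"
  using finite_Y_K b by (simp add: ancestors_def)

lemma ancestor_irrefl: "X \<notin> ancestors X"
  by (simp add: ancestors_iff)

lemma proj_ancestor:
  assumes "V \<in> ancestors X" "X \<in> I"
  shows "\<pi> X V = \<pi> X b"
proof (cases "V = b")
  case False
  with assms show ?thesis
    using proj_eq_of_far[of V X b] b \<theta>_less d_commute[of V X b] by (auto simp: ancestors_iff)
qed simp

text \<open>
  Seen from \<open>V\<close>, the vertex \<open>U\<close> lies in the direction of \<open>b\<close>, hence far from \<open>X\<close>. Then \<open>U\<close> in turn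
  does not distinguish \<open>V\<close> from \<open>X\<close>.
\<close>

lemma ancestor_trans_proj:
  assumes U: "U \<in> ancestors V" and V: "V \<in> ancestors X" and X: "X \<in> I"
  shows "\<pi> U V = \<pi> U X" "U \<in> ancestors X"
proof -
  have VI: "V \<in> I" and UI: "U \<in> I" and "V \<noteq> b" "X \<noteq> b" "V \<noteq> X" "U \<noteq> V"
    using U V by (auto simp: ancestors_iff)
  then have far: "ereal K < d V b X" using V by (simp add: ancestors_iff)
  have VU: "\<pi> V U = \<pi> V b" using proj_ancestor[OF U VI] .
  have "U \<noteq> X"
  proof
    assume "U = X"
    with VU have "d V b X \<le> ereal \<theta>" using d_same_le[of V b X] b VI \<open>V \<noteq> b\<close> by simp
    with \<theta>_less[OF far] show False by simp
  qed
  have "ereal \<theta> < d V U X" using \<theta>_less[OF far] d_cong[OF VU] by simp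
  then show "\<pi> U V = \<pi> U X"
    using proj_eq_of_far[of V U X] UI VI X \<open>U \<noteq> V\<close> \<open>U \<noteq> X\<close> \<open>V \<noteq> X\<close> by simp
  then have "d U b V = d U b X" by (simp add: proj_dist_def)
  with U \<open>U \<noteq> X\<close> \<open>X \<noteq> b\<close> show "U \<in> ancestors X" by (simp add: ancestors_iff)
qed

text \<open>
  As \<open>d\<^sub>A(b, X)\<close> exceeds \<open>2 * \<theta>\<close>, the projection of \<open>B\<close> to \<open>A\<close> is far from that of \<open>b\<close> or from that
  of \<open>X\<close>. In the first case \<open>A\<close> comes before \<open>B\<close>, in the second case \<open>B\<close> comes before \<open>A\<close>.
\<close>

lemma ancestors_linear:
  assumes A: "A \<in> ancestors X" and B: "B \<in> ancestors X" and "A \<noteq> B" and X: "X \<in> I"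
  shows "A \<in> ancestors B \<or> B \<in> ancestors A"
proof (cases "A = b \<or> B = b")
  case True
  with assms b show ?thesis by (auto simp: ancestors_iff)
next
  case False
  with A B have I: "A \<in> I" "B \<in> I" and ne: "A \<noteq> b" "B \<noteq> b" "A \<noteq> X" "B \<noteq> X" "X \<noteq> b"
    and far: "ereal K < d A b X" "ereal K < d B b X"
    by (auto simp: ancestors_iff)
  have "ereal \<theta> < d A b B \<or> ereal \<theta> < d A B X"
    using d_split[OF far(1), of B] I X b ne \<open>A \<noteq> B\<close> by auto
  then show ?thesis
  proof
    assume "ereal \<theta> < d A b B"
    then have "\<pi> B A = \<pi> B b"
      using proj_eq_of_far[of A B b] I b ne \<open>A \<noteq> B\<close> by (simp add: d_commute)
    from d_cong[OF this, of X] \<theta>_less[OF far(2)] have "ereal \<theta> < d B A X" by simp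
    then have "\<pi> A B = \<pi> A X" using proj_eq_of_far[of B A X] I X ne \<open>A \<noteq> B\<close> by simp
    then have "d A b B = d A b X" by (simp add: proj_dist_def)
    with far I ne \<open>A \<noteq> B\<close> show ?thesis by (simp add: ancestors_iff)
  next
    assume "ereal \<theta> < d A B X"
    then have "\<pi> B A = \<pi> B X" using proj_eq_of_far[of A B X] I X ne \<open>A \<noteq> B\<close> by simp
    then have "d B b A = d B b X" by (simp add: proj_dist_def)
    with far I ne \<open>A \<noteq> B\<close> show ?thesis by (simp add: ancestors_iff)
  qed
qed

lemma ancestors_subset: "V \<in> ancestors X \<Longrightarrow> X \<in> I \<Longrightarrow> ancestors V \<subseteq> ancestors X"
  using ancestor_trans_proj(2) by blast

lemma card_ancestors_less:
  assumes "V \<in> ancestors X" "X \<in> I"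
  shows "card (ancestors V) < card (ancestors X)"
proof (rule psubset_card_mono)
  show "ancestors V \<subset> ancestors X"
    using assms(1) ancestors_subset[OF assms] ancestor_irrefl[of V] by blast
qed (rule finite_ancestors[OF assms(2)])

lemma maximal_ancestor:
  assumes X: "X \<in> I" and S: "S \<subseteq> ancestors X" "S \<noteq> {}"
  shows "\<exists>M\<in>S. \<forall>V\<in>S. M \<notin> ancestors V"
proof -
  let ?h = "\<lambda>V. card (ancestors V)"
  have "finite S" using S(1) finite_ancestors[OF X] by (rule finite_subset)
  then have "Max (?h ` S) \<in> ?h ` S" using S(2) by simp
  then obtain M where M: "M \<in> S" "?h M = Max (?h ` S)" by auto
  have "M \<notin> ancestors V" if "V \<in> S" for V
  proof
    assume "M \<in> ancestors V"
    moreover have "V \<in> I" using that S(1) by (auto simp: ancestors_iff)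
    ultimately have "?h M < ?h V" by (rule card_ancestors_less)
    moreover have "?h V \<le> Max (?h ` S)" using that \<open>finite S\<close> by simp
    ultimately show False using M(2) by simp
  qed
  with M(1) show ?thesis by blast
qed

definition parent where
  "parent X = (SOME P. P \<in> ancestors X \<and> ancestors X = insert P (ancestors P))"

lemma parent:
  assumes "X \<in> I" "X \<noteq> b"
  shows parent_in: "parent X \<in> ancestors X"
    and ancestors_parent: "ancestors X = insert (parent X) (ancestors (parent X))"
proof -
  have "ancestors X \<noteq> {}" using assms by (simp add: ancestors_def)
  from maximal_ancestor[OF assms(1) subset_refl this]
  obtain P where P: "P \<in> ancestors X" "\<forall>V\<in>ancestors X. P \<notin> ancestors V" by blast
  have "V \<in> insert P (ancestors P)" if "V \<in> ancestors X" for V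
    using ancestors_linear[OF that P(1) _ assms(1)] P(2) that by blast
  then have "ancestors X = insert P (ancestors P)"
    using ancestors_subset[OF P(1) assms(1)] P(1) by blast
  with P(1) have "\<exists>P. P \<in> ancestors X \<and> ancestors X = insert P (ancestors P)" by blast
  from someI_ex[OF this, folded parent_def]
  show "parent X \<in> ancestors X" "ancestors X = insert (parent X) (ancestors (parent X))"
    by (rule conjunct1, rule conjunct2)
qed

lemma parent_carrier: "X \<in> I \<Longrightarrow> X \<noteq> b \<Longrightarrow> parent X \<in> I"
  and parent_neq: "X \<in> I \<Longrightarrow> X \<noteq> b \<Longrightarrow> parent X \<noteq> X"
  using parent_in by (auto simp: ancestors_iff)

text \<open>
  Suppose that \<open>W\<close> sees \<open>X\<close> and its parent \<open>M\<close> far apart. Then \<open>M\<close> sees \<open>W\<close> where it sees \<open>X\<close>, so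
  \<open>W\<close> is not an ancestor of \<open>M\<close>. But then \<open>W\<close> sees \<open>M\<close> where it sees \<open>b\<close>, so that it is an ancestor of
  \<open>X\<close>, although every ancestor of \<open>X\<close> other than \<open>M\<close> is an ancestor of \<open>M\<close>.
\<close>

lemma Y_K_parent:
  assumes X: "X \<in> I" "X \<noteq> b"
  shows "Y_K X (parent X) = {}"
proof (rule ccontr)
  define M where "M = parent X"
  have M: "M \<in> ancestors X" "M \<in> I" "M \<noteq> X"
    using parent_in[OF X] parent_carrier[OF X] parent_neq[OF X] by (auto simp: M_def)
  assume "Y_K X (parent X) \<noteq> {}"
  then obtain W where W: "W \<in> I" "W \<noteq> M" "W \<noteq> X" and far: "ereal K < d W M X"
    by (auto simp: Y_K_iff M_def d_commute)
  have MW: "\<pi> M W = \<pi> M X"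
    using proj_eq_of_far[OF \<theta>_less[OF far]] W M X by simp
  show False
  proof (cases "W \<in> ancestors X")
    case True
    then have W_M: "W \<in> ancestors M" using ancestors_parent[OF X] W(2) by (simp add: M_def)
    then have "\<pi> M W = \<pi> M b" "M \<noteq> b" using proj_ancestor M(2) by (auto simp: ancestors_iff)
    with MW have "d M b X \<le> ereal \<theta>" using d_same_le[of M b X] b M by simp
    with \<open>M \<noteq> b\<close> M(1) \<theta>_less show False by (fastforce simp: ancestors_iff)
  next
    case False
    then have "W \<noteq> b" using X b by (auto simp: ancestors_iff)
    have "\<pi> W M = \<pi> W b"
    proof (cases "M = b")
      case Mb: False
      have "d M W b = d M X b" using MW by (rule d_cong)
      then have "ereal \<theta> < d M W b"
        using M(1) Mb \<theta>_less by (simp add: ancestors_iff d_commute)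
      then show ?thesis using proj_eq_of_far[of M W b] W M b Mb \<open>W \<noteq> b\<close> by simp
    qed simp
    then have "ereal K < d W b X" using far by (simp add: proj_dist_def)
    with False W X show False by (simp add: ancestors_iff)
  qed
qed


section \<open>Few ancestors separate adjacent vertices\<close>

text \<open>
  For \<open>Z\<close> to share the ancestors of \<open>P\<close> it suffices that \<open>P\<close> sees \<open>Z\<close> at distance more than \<open>\<theta>\<close>,
  rather than \<open>K\<close>, from \<open>b\<close>.
\<close>

lemma ancestor_of_far:
  assumes U: "U \<in> ancestors P" and far: "ereal \<theta> < d P b Z"
    and PZ: "P \<in> I" "Z \<in> I" "Z \<noteq> b" "Z \<noteq> U" "Z \<noteq> P"
  shows "U \<in> ancestors Z"
proof -
  have UI: "U \<in> I" "U \<noteq> P" using U by (auto simp: ancestors_iff)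
  have "d P U Z = d P b Z" using proj_ancestor[OF U PZ(1)] by (rule d_cong)
  with far have "\<pi> U P = \<pi> U Z" using proj_eq_of_far[of P U Z] UI PZ by simp
  then have "d U b P = d U b Z" by (simp add: proj_dist_def)
  with U PZ show ?thesis by (simp add: ancestors_iff)
qed

lemma d_le_of_edge: "Y_K X Z = {} \<Longrightarrow> V \<in> I \<Longrightarrow> V \<noteq> X \<Longrightarrow> V \<noteq> Z \<Longrightarrow> d V X Z \<le> ereal K"
  using Y_K_iff[of V X Z] by (auto simp: not_less)

text \<open>
  Suppose that \<open>U\<close> is not an ancestor of \<open>Z\<close>. Then \<open>V\<close> sees \<open>Z\<close> close to \<open>b\<close>, so far from \<open>X\<close> and \<open>P\<close>,
  which it does not distinguish. Hence \<open>P\<close> sees \<open>Z\<close> in the direction of \<open>V\<close>, that is exactly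
  where it sees \<open>b\<close>, and \<open>d\<^sub>P(X, Z) = d\<^sub>P(X, b) > K\<close> contradicts the adjacency of \<open>X\<close> and \<open>Z\<close>.
\<close>

lemma ancestor_of_long_chain:
  assumes edge: "Y_K X Z = {}" and X: "X \<in> I" and Z: "Z \<in> I" "Z \<noteq> b" "Z \<noteq> X" "Z \<notin> ancestors X"
    and U: "U \<in> ancestors V" and V: "V \<in> ancestors P" and P: "P \<in> ancestors X"
  shows "U \<in> ancestors Z"
proof (rule ccontr)
  assume not: "U \<notin> ancestors Z"
  have VX: "V \<in> ancestors X" "\<pi> V P = \<pi> V X" using ancestor_trans_proj[OF V P X] by auto
  have UX: "U \<in> ancestors X" using ancestor_trans_proj(2)[OF U VX(1) X] .
  have I: "P \<in> I" "V \<in> I" and ne: "P \<noteq> b" "V \<noteq> b" "V \<noteq> P" "P \<noteq> X" "V \<noteq> X"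
    and far: "ereal K < d P b X" "ereal K < d V b X"
    using U V P VX(1) by (auto simp: ancestors_iff)
  have Zne: "Z \<noteq> U" "Z \<noteq> V" "Z \<noteq> P" using Z(4) UX VX(1) P by auto
  have "\<not> ereal \<theta> < d V b Z"
    using ancestor_of_far[OF U _ I(2) Z(1,2) Zne(1,2)] not by blast
  then have "ereal \<theta> < d V Z X"
    using d_split[OF far(2), of Z] I X Z b ne Zne by auto
  then have "ereal \<theta> < d V P Z" using d_cong[OF VX(2), of Z] by (simp add: d_commute)
  then have "\<pi> P V = \<pi> P Z" using proj_eq_of_far[of V P Z] I Z ne Zne by simp
  then have "d P b X = d P X Z"
    using proj_ancestor[OF V I(1)] by (simp add: proj_dist_def Un_commute)
  with far(1) d_le_of_edge[OF edge I(1)] ne Zne show False by (simp add: not_less[symmetric])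
qed

text \<open>
  Any further ancestor \<open>U\<close> of \<open>X\<close> is the first element of a chain \<open>U\<close>, \<open>parent (parent X)\<close>,
  \<open>parent X\<close> to which the previous lemma applies.
\<close>

lemma few_separating_ancestors:
  assumes "Y_K X Z = {}" "X \<in> I" "X \<noteq> b" "Z \<in> I" "Z \<noteq> b" "Z \<noteq> X" "Z \<notin> ancestors X"
  shows "ancestors X - ancestors Z \<subseteq> {parent X, parent (parent X)}"
proof
  fix U assume U: "U \<in> ancestors X - ancestors Z"
  show "U \<in> {parent X, parent (parent X)}"
  proof (rule ccontr)
    assume ne: "U \<notin> {parent X, parent (parent X)}"
    then have UP: "U \<in> ancestors (parent X)" using U ancestors_parent assms(2,3) by blast
    then have P: "parent X \<in> I" "parent X \<noteq> b"
      using parent_carrier assms(2,3) by (auto simp: ancestors_iff)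
    have "U \<in> ancestors (parent (parent X))" using UP ne ancestors_parent[OF P] by blast
    then show False
      using ancestor_of_long_chain[OF assms(1,2,4-7)] parent_in P assms(2,3) U by blast
  qed
qed

section \<open>The tree of spaces and its distances\<close>

definition parent_tree where
  "parent_tree = (I, {{X, parent X} | X. X \<in> I - {b}})"

definition attach where
  "attach X Y = (SOME x. x \<in> \<pi> X Y)"

abbreviation near where
  "near \<equiv> path_within I C K (tree_bridges parent_tree attach)"

lemma attach_in: "X \<in> I \<Longrightarrow> Y \<in> I \<Longrightarrow> X \<noteq> Y \<Longrightarrow> attach X Y \<in> \<pi> X Y"
  using proj_nonempty[of X Y] unfolding attach_def by (auto intro: someI)

lemma near_space:
  assumes "Y \<in> I" "X \<in> I" "Z \<in> I" "X \<noteq> Y" "Z \<noteq> Y" "x \<in> \<pi> Y X" "z \<in> \<pi> Y Z"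
    and "d Y X Z \<le> ereal r"
  shows "near (Point Y x) (Point Y z) r"
  using assms proj_mspace geodesic d_bound[OF assms(8), of x z] by (intro path_within_space) blast+

lemma near_proj:
  assumes "Y \<in> I" "X \<in> I" "X \<noteq> Y" "x \<in> \<pi> Y X" "z \<in> \<pi> Y X"
  shows "near (Point Y x) (Point Y z) \<theta>"
  using near_space[OF assms(1,2,2,3,3,4,5)] d_same_le[OF assms(1-3) refl] by blast

lemma near_parent:
  assumes "X \<in> I" "X \<noteq> b"
  shows "near (Point X (attach X (parent X))) (Point (parent X) (attach (parent X) X)) K"
  using assms \<theta>(3) by (intro path_within_bridge) (auto simp: tree_bridges_def parent_tree_def)

text \<open>
  Each step of the climb to the parent crosses a bridge of length \<open>K\<close> and moves by at most \<open>\<theta>\<close> inside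
  one projection. At each vertex strictly between \<open>M\<close> and \<open>X\<close> the climb also has to move from the
  projection of \<open>X\<close> to that of \<open>b\<close>, which costs at most \<open>2 * K\<close>. So a step with such a move
  costs at most \<open>4 * K\<close>, and the last step costs \<open>K + 2 * \<theta> \<le> 2 * K\<close>.
\<close>

lemma near_ancestor:
  assumes "X \<in> I" "M \<in> ancestors X" "x \<in> \<pi> X b" "m \<in> \<pi> M X"
    and "\<And>V. V \<in> ancestors X \<Longrightarrow> M \<in> ancestors V \<Longrightarrow> d V b X \<le> ereal (2 * K)"
  shows "near (Point X x) (Point M m) ((4 * real (card {V \<in> ancestors X. M \<in> ancestors V}) + 2) * K)"
  using assms
proof (induction "card (ancestors X)" arbitrary: X x m rule: less_induct)
  case less
  note X = \<open>X \<in> I\<close> and M = \<open>M \<in> ancestors X\<close> and x = \<open>x \<in> \<pi> X b\<close> and m = \<open>m \<in> \<pi> M X\<close>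
  define P where "P = parent X"
  have Xb: "X \<noteq> b" using M by (simp add: ancestors_iff)
  have P: "P \<in> ancestors X" "P \<in> I" "P \<noteq> X" "ancestors X = insert P (ancestors P)"
    using parent_in parent_carrier parent_neq ancestors_parent X Xb by (auto simp: P_def)
  have "x \<in> \<pi> X P" using x proj_ancestor[OF P(1) X] by simp
  then have "near (Point X x) (Point X (attach X P)) \<theta>"
    using near_proj attach_in X P by metis
  from path_within_trans[OF this near_parent[OF X Xb, folded P_def]]
  have step: "near (Point X x) (Point P (attach P X)) (\<theta> + K)" .
  have PX: "attach P X \<in> \<pi> P X" using attach_in X P by metis
  show ?case
  proof (cases "M = P")
    case True
    then have "near (Point P (attach P X)) (Point M m) \<theta>"
      using near_proj[of P X] PX m X P by simp
    from path_within_trans[OF step this]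
    have "near (Point X x) (Point M m) (\<theta> + K + \<theta>)" .
    moreover have "\<theta> + K + \<theta> \<le> (4 * real n + 2) * K" for n
      using K \<theta>(3) by (simp add: algebra_simps add_increasing2)
    ultimately show ?thesis by (rule path_within_mono)
  next
    case False
    with M P have MP: "M \<in> ancestors P" by auto
    then have Pb: "P \<noteq> b" by (auto simp: ancestors_iff)
    have V: "V \<in> ancestors X" "d V b P = d V b X" if "V \<in> ancestors P" for V
      using ancestor_trans_proj[OF that P(1) X] by (auto simp: proj_dist_def)
    let ?S = "{V \<in> ancestors P. M \<in> ancestors V}"
    have "{V \<in> ancestors X. M \<in> ancestors V} = insert P ?S" using P(4) MP by auto
    moreover have "finite ?S" "P \<notin> ?S"
      using finite_ancestors[OF P(2)] ancestor_irrefl by auto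
    ultimately have card: "card {V \<in> ancestors X. M \<in> ancestors V} = Suc (card ?S)" by simp
    obtain y where y: "y \<in> \<pi> P b" using proj_nonempty[of P b] b P(2) Pb by blast
    have "d P X b \<le> ereal (2 * K)" using less.prems(5)[OF P(1) MP] by (simp add: d_commute)
    then have 1: "near (Point P (attach P X)) (Point P y) (2 * K)"
      using near_space[of P X b] PX y X P b Pb by simp
    have mP: "m \<in> \<pi> M P" using m ancestor_trans_proj(1)[OF MP P(1) X] by simp
    have "d V b P \<le> ereal (2 * K)" if "V \<in> ancestors P" "M \<in> ancestors V" for V
      using less.prems(5)[OF V(1) that(2)] V(2) that(1) by simp
    from less.hyps[OF card_ancestors_less[OF P(1) X] P(2) MP y mP this]
    have "near (Point P y) (Point M m) ((4 * real (card ?S) + 2) * K)" .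
    from path_within_trans[OF path_within_trans[OF step 1] this]
    have "near (Point X x) (Point M m) (\<theta> + K + 2 * K + (4 * real (card ?S) + 2) * K)" .
    then show ?thesis
      by (rule path_within_mono) (use \<theta> in \<open>simp add: card algebra_simps\<close>)
  qed
qed

text \<open>
  Here \<open>Z\<close> is the parent of \<open>X\<close>: a vertex \<open>V\<close> strictly between them would see \<open>Z\<close> where it sees \<open>b\<close>,
  and so would see \<open>X\<close> and \<open>Z\<close> at distance more than \<open>K\<close>.
\<close>

lemma near_edge_ancestor:
  assumes XZ: "X \<in> I" "Z \<in> ancestors X" and edge: "Y_K X Z = {}"
    and xz: "x \<in> \<pi> X Z" "z \<in> \<pi> Z X"
  shows "near (Point X x) (Point Z z) (2 * K)"
proof -
  have none: "Z \<notin> ancestors V" if V: "V \<in> ancestors X" for V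
  proof
    assume ZV: "Z \<in> ancestors V"
    have VI: "V \<in> I" "V \<noteq> b" "V \<noteq> X" "V \<noteq> Z" "ereal K < d V b X"
      using V ZV by (auto simp: ancestors_iff)
    have "d V X Z = d V b X" using d_cong[OF proj_ancestor[OF ZV VI(1)]] by (simp add: d_commute)
    with d_le_of_edge[OF edge VI(1,3,4)] VI(5) show False by simp
  qed
  then have empty: "{V \<in> ancestors X. Z \<in> ancestors V} = {}" by blast
  have "x \<in> \<pi> X b" using xz(1) proj_ancestor[OF XZ(2,1)] by simp
  from near_ancestor[OF XZ this xz(2)] none
  have "near (Point X x) (Point Z z)
      ((4 * real (card {V \<in> ancestors X. Z \<in> ancestors V}) + 2) * K)" by blast
  then show ?thesis unfolding empty by simp
qed

text \<open>
  A vertex strictly between \<open>M\<close> and \<open>X\<close> is not an ancestor of \<open>Z\<close>, by the choice of \<open>M\<close>. Hence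
  there are at most two of them, and the climb costs at most \<open>(4 * 2 + 2) * K\<close>. Inside the space of
  \<open>X\<close> one first has to move from the projection of \<open>Z\<close> to that of \<open>b\<close>. This costs at most \<open>K\<close>,
  because \<open>X\<close> is not an ancestor of \<open>Z\<close>.
\<close>

lemma near_common_ancestor:
  assumes edge: "Y_K X Z = {}" and X: "X \<in> I" "X \<noteq> b" "X \<notin> ancestors Z"
    and Z: "Z \<in> I" "Z \<noteq> b" "Z \<noteq> X" "Z \<notin> ancestors X"
    and M: "M \<in> ancestors X" and max: "\<And>V. V \<in> ancestors X \<inter> ancestors Z \<Longrightarrow> M \<notin> ancestors V"
    and xm: "x \<in> \<pi> X Z" "m \<in> \<pi> M X"
  shows "near (Point X x) (Point M m) (11 * K)"
proof -
  let ?S = "{V \<in> ancestors X. M \<in> ancestors V}"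
  have "?S \<subseteq> ancestors X - ancestors Z" using max by blast
  also have "\<dots> \<subseteq> {parent X, parent (parent X)}"
    using few_separating_ancestors edge X Z by blast
  finally have "card ?S \<le> card {parent X, parent (parent X)}" by (rule card_mono[rotated]) simp
  also have "\<dots> \<le> 2" by (simp add: card_insert_if)
  finally have card: "real (card ?S) \<le> 2" by simp
  obtain x' where x': "x' \<in> \<pi> X b" using proj_nonempty[of X b] X b by blast
  have "d X Z b \<le> ereal K"
    using X Z by (auto simp: ancestors_iff not_less d_commute)
  then have 1: "near (Point X x) (Point X x') K"
    using near_space[of X Z b] X Z b xm(1) x' by simp
  have "d V b X \<le> ereal (2 * K)" if V: "V \<in> ancestors X" "M \<in> ancestors V" for V
  proof -
    have "V \<notin> ancestors Z" using V max by blast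
    moreover have VI: "V \<in> I" "V \<noteq> X" "V \<noteq> b" "V \<noteq> Z" using V Z by (auto simp: ancestors_iff)
    ultimately have "d V b Z \<le> ereal K" using Z by (auto simp: ancestors_iff not_less)
    moreover have "d V Z X \<le> ereal K"
      using d_le_of_edge[OF edge VI(1,2,4)] by (simp add: d_commute)
    ultimately have "d V b X \<le> ereal (K + K)"
      by (rule d_triangle) (use X Z b VI in auto)
    then show ?thesis by simp
  qed
  from near_ancestor[OF X(1) M x' xm(2) this]
  have "near (Point X x') (Point M m) ((4 * real (card ?S) + 2) * K)" .
  moreover have "(4 * real (card ?S) + 2) * K \<le> 10 * K"
    using card \<theta>(3) by (intro mult_right_mono) auto
  ultimately have "near (Point X x') (Point M m) (10 * K)" by (rule path_within_mono)
  from path_within_trans[OF 1 this] show ?thesis by simp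
qed

lemma near_edge:
  assumes X: "X \<in> I" and Z: "Z \<in> I" "X \<noteq> Z" and edge: "Y_K X Z = {}"
    and xz: "x \<in> \<pi> X Z" "z \<in> \<pi> Z X"
  shows "near (Point X x) (Point Z z) (23 * K)"
proof -
  have edge': "Y_K Z X = {}" using edge unfolding Y_K_commute[of X Z] .
  consider (up) "Z \<in> ancestors X" | (down) "X \<in> ancestors Z"
    | (incomparable) "Z \<notin> ancestors X" "X \<notin> ancestors Z" by blast
  then show ?thesis
  proof cases
    case up
    from near_edge_ancestor[OF X this edge xz] show ?thesis
      by (rule path_within_mono) (use \<theta> in simp)
  next
    case down
    from path_within_sym[OF near_edge_ancestor[OF Z(1) this edge' xz(2,1)]] show ?thesis
      by (rule path_within_mono) (use \<theta> in simp)
  next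
    case incomparable
    then have ne: "X \<noteq> b" "Z \<noteq> b" using X Z b by (auto simp: ancestors_iff)
    have "b \<in> ancestors X \<inter> ancestors Z" using ne b by (simp add: ancestors_iff)
    then obtain M where M: "M \<in> ancestors X \<inter> ancestors Z"
      and max: "\<forall>V\<in>ancestors X \<inter> ancestors Z. M \<notin> ancestors V"
      using maximal_ancestor[OF X, of "ancestors X \<inter> ancestors Z"] by blast
    have MI: "M \<in> I" "M \<noteq> X" "M \<noteq> Z" using M by (auto simp: ancestors_iff)
    obtain m m' where m: "m \<in> \<pi> M X" "m' \<in> \<pi> M Z"
      using proj_nonempty[of M] MI X Z by blast
    have "near (Point X x) (Point M m) (11 * K)"
      using near_common_ancestor[OF edge X ne(1) _ Z(1) ne(2)] incomparable Z(2) M max xz(1) m(1)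
      by blast
    moreover have "near (Point M m) (Point M m') K"
      using near_space[of M X Z] MI X Z m d_le_of_edge[OF edge] by simp
    moreover have "near (Point M m') (Point Z z) (11 * K)"
      using near_common_ancestor[OF edge' Z(1) ne(2) _ X ne(1)] incomparable Z(2) M max xz(2) m(2)
      by (blast intro: path_within_sym)
    ultimately have "near (Point X x) (Point Z z) (11 * K + K + 11 * K)"
      by (meson path_within_trans)
    then show ?thesis by (rule path_within_mono) (use \<theta> in simp)
  qed
qed

lemma complex_edge_iff:
  "{X, Z} \<in> snd (projection_complex I C \<pi> K) \<longleftrightarrow> X \<in> I \<and> Z \<in> I \<and> X \<noteq> Z \<and> Y_K X Z = {}"
  unfolding projection_complex_def using Y_K_commute by (auto simp: doubleton_eq_iff)

lemma parent_tree_edgeD: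
  assumes "{X, Y} \<in> snd parent_tree"
  shows "{X, Y} \<in> snd (projection_complex I C \<pi> K)"
proof -
  obtain V where V: "V \<in> I" "V \<noteq> b" "{X, Y} = {V, parent V}"
    using assms unfolding parent_tree_def by auto
  then show ?thesis
    using complex_edge_iff Y_K_parent[OF V(1,2)] parent_carrier[OF V(1,2)] parent_neq[OF V(1,2)]
    by auto
qed

lemma tree_of_spaces_data_parent_tree: "tree_of_spaces_data I C \<pi> K parent_tree attach"
proof -
  have tree: "tree_graph parent_tree"
    unfolding parent_tree_def
    by (rule tree_graph_parent[where h = "\<lambda>X. card (ancestors X)"])
      (use b parent_carrier parent_in card_ancestors_less in auto)
  have "snd parent_tree \<subseteq> snd (projection_complex I C \<pi> K)"
    using parent_tree_edgeD unfolding parent_tree_def by fastforce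
  moreover have "attach X Y \<in> \<pi> X Y" if "{X, Y} \<in> snd parent_tree" for X Y
    using parent_tree_edgeD[OF that] complex_edge_iff attach_in by blast
  ultimately show ?thesis
    using tree unfolding tree_of_spaces_data_def is_subgraph_def tree_graph_def
    by (auto simp: parent_tree_def projection_complex_def)
qed

lemma tree_bridges_subset: "tree_bridges parent_tree attach \<subseteq> quasi_tree_bridges I C \<pi> K"
proof -
  have "attach X Y \<in> \<pi> X Y" "attach Y X \<in> \<pi> Y X" if "{X, Y} \<in> snd parent_tree" for X Y
    using parent_tree_edgeD[OF that] complex_edge_iff attach_in by blast+
  with parent_tree_edgeD show ?thesis
    unfolding tree_bridges_def quasi_tree_bridges_def by blast
qed

end

theorem theorem1p2:
  fixes I :: "'i set"
    and C :: "'i \<Rightarrow> 'a metric"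
    and \<pi> :: "'i \<Rightarrow> 'i \<Rightarrow> 'a set"
    and \<theta> K :: real
  assumes "I \<noteq> {}"
    and "\<And>Y. Y \<in> I \<Longrightarrow> geodesic_space (C Y)"
    and "projections I C \<pi>"
    and "strong_projection_axioms I C \<pi> \<theta>"
    and "K \<ge> 4 * \<theta>"
  shows "\<exists>T p. tree_of_spaces_data I C \<pi> K T p \<and>
           tree_space I C K T p \<subseteq> quasi_tree_space I C \<pi> K \<and>
           quasi_isometry (tree_space I C K T p) (tree_metric I C K T p)
             (quasi_tree_space I C \<pi> K) (quasi_tree_metric I C \<pi> K) (\<lambda>x. x)"
proof -
  obtain b where "b \<in> I" using assms(1) by blast
  have "0 \<le> \<theta>" using assms(4) by (simp add: strong_projection_axioms_def)
  interpret rooted_projections I C \<pi> \<theta> K b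
    by unfold_locales (use assms \<open>b \<in> I\<close> \<open>0 \<le> \<theta>\<close> in auto)
  have "fst u \<in> I \<and> snd u \<in> mspace (C (fst u)) \<and>
      near (Point (fst u) (snd u)) (Point (fst v) (snd v)) (23 * K)"
    if bridge: "(u, v) \<in> quasi_tree_bridges I C \<pi> K" for u v
  proof -
    obtain X x Y y where uv: "u = (X, x)" "v = (Y, y)"
      and XY: "X \<in> I" "Y \<in> I" "X \<noteq> Y" "Y_K X Y = {}" and xy: "x \<in> \<pi> X Y" "y \<in> \<pi> Y X"
      using bridge complex_edge_iff unfolding quasi_tree_bridges_def by blast
    then show ?thesis using near_edge[OF XY xy] proj_mspace[of X Y] by auto
  qed
  then have "quasi_isometry (tree_space I C K parent_tree attach)
      (tree_metric I C K parent_tree attach)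
      (quasi_tree_space I C \<pi> K) (quasi_tree_metric I C \<pi> K) (\<lambda>x. x)"
    unfolding tree_space_def tree_metric_def quasi_tree_space_def quasi_tree_metric_def
    using quasi_isometry_of_bridge_bound[OF \<theta>(3) _ tree_bridges_subset, where c = 23] by simp
  moreover have "tree_space I C K parent_tree attach \<subseteq> quasi_tree_space I C \<pi> K"
    unfolding tree_space_def quasi_tree_space_def by (rule glued_space_mono[OF tree_bridges_subset])
  ultimately show ?thesis using tree_of_spaces_data_parent_tree by blast
qed

end
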